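(* Let $(f_n)_{n\in\mathbb N}$ be a collection of diffeomorphisms in $\mathrm{Diff}^1_+([0,1])$, each different from the identity and without hyperbolic fixed points, and for each $n$ let $I_n$ be a fundamental domain of $f_n$. Assume that for all $i<n$ one of the following holds: $\mathrm{Supp}(f_n)\subset I_i$; or $\mathrm{Supp}(f_i)\subset I_n$; or the interiors of $\mathrm{Supp}(f_n)$ and $\mathrm{Supp}(f_i)$ are disjoint. Then the group $\langle f_n, n\in\mathbb N\rangle$ generated by the $f_n$ is $C^1$-close to the identity.
   Context: $\mathrm{Supp}(f)$ denotes the support of $f$, the closure of $\{x: f(x)\neq x\}$. A fundamental domain of $f$ is a segment with endpoints $x$ and $f(x)$ for some $x$ with $f(x)\neq x$. A diffeomorphism is without hyperbolic fixed points if its derivative equals $1$ at each of its fixed points. A group $G\subset \mathrm{Diff}^1_+([0,1])$ is $C^1$-close to the identity if there is a sequence $h_n\in \mathrm{Diff}^1_+([0,1])$ such that $h_n g h_n^{-1}\to \mathrm{id}$ in the $C^1$-topology for every $g\in G$. *)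

theory Defs
  imports "HOL-Analysis.Analysis"
begin

text \<open>Elements of Diff^1_+([0,1]) are represented as maps real => real that are the
identity outside [0,1], increasing C^1 bijections of [0,1] with positive derivative
(one-sided derivatives at the endpoints).\<close>

definition diff1p :: "(real \<Rightarrow> real) \<Rightarrow> bool" where
  "diff1p f \<longleftrightarrow> bij_betw f {0..1} {0..1} \<and> (\<forall>x. x \<notin> {0..1} \<longrightarrow> f x = x) \<and>
     mono_on {0..1} f \<and>
     (\<exists>f'. continuous_on {0..1} f' \<and>
        (\<forall>x\<in>{0..1}. (f has_real_derivative f' x) (at x within {0..1}) \<and> f' x > 0))"

definition d1 :: "(real \<Rightarrow> real) \<Rightarrow> real \<Rightarrow> real" where
  "d1 f x = (THE d. (f has_real_derivative d) (at x within {0..1}))"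

definition supp :: "(real \<Rightarrow> real) \<Rightarrow> real set" where
  "supp f = closure {x. f x \<noteq> x}"

definition fundamental_domain :: "(real \<Rightarrow> real) \<Rightarrow> real set \<Rightarrow> bool" where
  "fundamental_domain f I \<longleftrightarrow> (\<exists>x. f x \<noteq> x \<and> I = closed_segment x (f x))"

definition no_hyperbolic_fixed_points :: "(real \<Rightarrow> real) \<Rightarrow> bool" where
  "no_hyperbolic_fixed_points f \<longleftrightarrow>
     (\<forall>x\<in>{0..1}. f x = x \<longrightarrow> (f has_real_derivative 1) (at x within {0..1}))"

inductive_set gen_group :: "(real \<Rightarrow> real) set \<Rightarrow> (real \<Rightarrow> real) set" for F where
  gen_id: "id \<in> gen_group F"
| gen_mult: "g \<in> gen_group F \<Longrightarrow> f \<in> F \<Longrightarrow> f \<circ> g \<in> gen_group F"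
| gen_inv: "g \<in> gen_group F \<Longrightarrow> f \<in> F \<Longrightarrow> inv f \<circ> g \<in> gen_group F"

definition C1_tendsto_id :: "(nat \<Rightarrow> real \<Rightarrow> real) \<Rightarrow> bool" where
  "C1_tendsto_id \<phi> \<longleftrightarrow> (\<forall>\<epsilon>>0. \<forall>\<^sub>F n in sequentially. \<forall>x\<in>{0..1}.
       \<bar>\<phi> n x - x\<bar> < \<epsilon> \<and> \<bar>d1 (\<phi> n) x - 1\<bar> < \<epsilon>)"

definition C1_close_to_id :: "(real \<Rightarrow> real) set \<Rightarrow> bool" where
  "C1_close_to_id G \<longleftrightarrow> (\<exists>h :: nat \<Rightarrow> real \<Rightarrow> real. (\<forall>n. diff1p (h n)) \<and>
     (\<forall>g\<in>G. C1_tendsto_id (\<lambda>n. h n \<circ> g \<circ> inv (h n))))"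

end

theory Submission
  imports Defs
begin

text \<open>
  A diffeomorphism \<open>h\<close> with log-density \<open>u = ln h' + const\<close> conjugates \<open>f\<close> to a map with
  log-derivative \<open>u (f x) - u x + ln (f' x)\<close> at \<open>h x\<close>. It therefore suffices to find, for every
  finite subfamily and every \<open>\<epsilon>\<close>, a continuous \<open>u\<close> making all these quantities smaller than
  \<open>\<epsilon>\<close>; the bound passes to products and inverses because it is a cocycle.

  For a single \<open>f\<close> one takes the average of the first Birkhoff sums of \<open>ln f'\<close>: the error is the
  Birkhoff average of \<open>ln f'\<close>, which tends to 0 uniformly because orbits accumulate only at
  fixed points, where \<open>ln f' = 0\<close>. For a finite family one adds a map \<open>f m\<close> whose fundamental
  domain \<open>J\<close> is longest, so that every other map is supported either in \<open>J\<close> or off the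
  support of \<open>f m\<close>. The single-map solution for \<open>f m\<close> is corrected on \<open>J\<close> to the solution for
  the other maps, and the correction is propagated along the orbit of \<open>J\<close> with slowly decaying
  coefficients, which makes it almost invariant under \<open>f m\<close>. The endpoint values on \<open>J\<close> are
  matched by logarithmic bumps, almost invariant under maps fixing the endpoints.
\<close>

section \<open>One map: almost solving the cohomological equation by averaging\<close>

lemma continuous_on_funpow:
  fixes f :: "'a::topological_space \<Rightarrow> 'a"
  assumes "continuous_on UNIV f"
  shows "continuous_on UNIV (f^^n)"
proof (induction n)
  case 0
  show ?case by (simp add: id_def)
next
  case (Suc n)
  show ?case
    using continuous_on_compose[OF Suc continuous_on_subset[OF assms]] by simp
qed

text \<open>With \<open>u\<close> the mean of the first \<open>n\<close> Birkhoff sums of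
  \<open>\<psi>\<close>, the defect \<open>u (f x) - u x + \<psi> x\<close> is the Birkhoff average
  of \<open>\<psi>\<close> over \<open>n\<close> points starting at \<open>f x\<close>. It is at
  most \<open>\<epsilon>/2 + C/n\<close>: the size of \<open>\<psi>\<close> is controlled by the
  displacement of \<open>f\<close>, and the displacements along an orbit in [0,1] sum to at most
  1.\<close>

lemma averaged_coboundary:
  fixes f \<psi> :: "real \<Rightarrow> real"
  assumes mono: "strict_mono f" and cf: "continuous_on UNIV f"
    and out: "\<And>x. x \<notin> {0..1} \<Longrightarrow> f x = x"
    and c\<psi>: "continuous_on UNIV \<psi>" and fix0: "\<And>x. f x = x \<Longrightarrow> \<psi> x = 0"
    and "\<epsilon> > 0"
  shows "\<exists>u. continuous_on UNIV u \<and> (\<forall>x. f x = x \<longrightarrow> u x = 0) \<and>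
    (\<forall>x. \<bar>u (f x) - u x + \<psi> x\<bar> < \<epsilon>)"
proof -
  \<comment> \<open>\<open>\<psi>\<close> reaches size \<open>\<epsilon>/2\<close> only on a compact
    set \<open>K\<close> free of fixed points, where dividing by the displacement gives a bounded
    function.\<close>
  obtain C where C: "C \<ge> 0" "\<And>y. \<bar>\<psi> y\<bar> \<le> \<epsilon>/2 + C * \<bar>f y - y\<bar>"
  proof -
    define K where "K = {0..1} \<inter> {x. \<epsilon>/2 \<le> \<bar>\<psi> x\<bar>}"
    have "closed {x. \<epsilon>/2 \<le> \<bar>\<psi> x\<bar>}"
      by (intro closed_Collect_le continuous_intros c\<psi>)
    then have K: "compact K"
      unfolding K_def by (intro compact_Int_closed compact_Icc)
    have nf: "f x \<noteq> x" if "x \<in> K" for x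
      using that fix0[of x] \<open>\<epsilon> > 0\<close> by (auto simp: K_def)
    have "bounded ((\<lambda>x. \<psi> x / (f x - x)) ` K)"
      by (intro compact_imp_bounded compact_continuous_image K continuous_intros
          continuous_on_subset[OF c\<psi>] continuous_on_subset[OF cf]) (use nf in auto)
    then obtain C where C: "\<And>x. x \<in> K \<Longrightarrow> \<bar>\<psi> x / (f x - x)\<bar> \<le> C" "C > 0"
      unfolding bounded_pos by auto
    show ?thesis
    proof (rule that)
      show "C \<ge> 0" using C by simp
      show "\<bar>\<psi> y\<bar> \<le> \<epsilon>/2 + C * \<bar>f y - y\<bar>" for y
      proof (cases "y \<in> K")
        case True
        then have "\<bar>\<psi> y\<bar> \<le> C * \<bar>f y - y\<bar>"
          using C(1)[OF True] nf[OF True] by (simp add: abs_divide divide_le_eq)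
        then show ?thesis using \<open>\<epsilon> > 0\<close> by linarith
      next
        case False
        then have "\<bar>\<psi> y\<bar> \<le> \<epsilon>/2"
          using out[of y] fix0[of y] \<open>\<epsilon> > 0\<close> by (cases "y \<in> {0..1}") (auto simp: K_def)
        moreover have "0 \<le> C * \<bar>f y - y\<bar>" using C by simp
        ultimately show ?thesis by linarith
      qed
    qed
  qed
  have m: "mono f" using mono by (rule strict_mono_mono)
  \<comment> \<open>A first point outside [0,1] would be fixed, and injectivity would make its
    predecessor equal to it.\<close>
  have in01: "(f ^^ k) x \<in> {0..1}" if "x \<in> {0..1}" for k x
  proof (induction k)
    case (Suc k)
    show ?case
    proof (rule ccontr)
      assume "\<not> ?case"
      then have "f (f ((f^^k) x)) = f ((f^^k) x)" using out by simp
      then have "f ((f^^k) x) = (f^^k) x" using strict_mono_eq[OF mono] by blast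
      then show False using Suc \<open>\<not> ?case\<close> by simp
    qed
  qed (use that in auto)
  \<comment> \<open>Orbits of an increasing map are monotone, so all displacements have one sign and
    telescope.\<close>
  have tele: "(\<Sum>k<n. \<bar>f ((f^^k) x) - (f^^k) x\<bar>) = \<bar>(f^^n) x - x\<bar>" for n x
  proof (cases "x \<le> f x")
    case True
    have "(f^^k) x \<le> f ((f^^k) x)" for k
      by (induction k) (use True m in \<open>auto simp: monoD\<close>)
    moreover from this have "x \<le> (f^^n) x" by (induction n) (auto intro: order_trans)
    ultimately show ?thesis
      using sum_lessThan_telescope[of "\<lambda>k. (f^^k) x" n] by simp
  next
    case False
    have "(f^^k) x \<ge> f ((f^^k) x)" for k
      by (induction k) (use False m in \<open>auto simp: monoD\<close>)
    moreover from this have "x \<ge> (f^^n) x" by (induction n) (auto intro: order_trans)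
    ultimately show ?thesis
      using sum_lessThan_telescope'[of "\<lambda>k. (f^^k) x" n] by simp
  qed
  obtain n :: nat where n: "n > 0" "C / real n < \<epsilon>/2"
  proof -
    obtain n :: nat where "C / (\<epsilon>/2) < real n" using reals_Archimedean2 by blast
    moreover have "C / (\<epsilon>/2) \<ge> 0" using C \<open>\<epsilon> > 0\<close> by simp
    ultimately show ?thesis using that[of n] \<open>\<epsilon> > 0\<close>
      by (cases "n = 0") (simp_all add: field_simps)
  qed
  define u where "u x = (\<Sum>k<n. \<Sum>l\<le>k. \<psi> ((f^^l) x)) / real n" for x
  have "continuous_on UNIV u"
    unfolding u_def using n
    by (intro continuous_intros continuous_on_compose2[OF c\<psi> continuous_on_funpow[OF cf]]) auto
  moreover have "u x = 0" if "f x = x" for x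
  proof -
    have "(f^^l) x = x" for l by (induction l) (use that in auto)
    then show ?thesis using fix0[OF that] by (simp add: u_def)
  qed
  moreover have "\<bar>u (f x) - u x + \<psi> x\<bar> < \<epsilon>" for x
  proof (cases "f x = x")
    case True
    then show ?thesis using fix0[OF True] \<open>\<epsilon> > 0\<close> by simp
  next
    case False
    then have x: "x \<in> {0..1}" using out by blast
    have fp: "(f^^l) (f x) = f ((f^^l) x)" for l
      using funpow_swap1[of f l x] by simp
    \<comment> \<open>Passing from \<open>x\<close> to \<open>f x\<close> shifts the window of each
      Birkhoff sum by one, so only the two end terms survive.\<close>
    have "(\<Sum>l\<le>k. \<psi> ((f^^l) (f x))) - (\<Sum>l\<le>k. \<psi> ((f^^l) x)) = \<psi> ((f^^Suc k) x) - \<psi> x" for k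
      by (induction k) (auto simp: fp)
    then have "u (f x) - u x = (\<Sum>k<n. \<psi> ((f^^Suc k) x) - \<psi> x) / n"
      unfolding u_def diff_divide_distrib[symmetric] sum_subtractf[symmetric] by simp
    also have "\<dots> = (\<Sum>k<n. \<psi> ((f^^Suc k) x)) / n - \<psi> x"
      using n by (simp add: sum_subtractf diff_divide_distrib)
    finally have eq: "u (f x) - u x + \<psi> x = (\<Sum>k<n. \<psi> ((f^^k) (f x))) / n"
      by (simp add: fp)
    have "\<bar>\<Sum>k<n. \<psi> ((f^^k) (f x))\<bar> \<le> (\<Sum>k<n. \<epsilon>/2 + C * \<bar>f ((f^^k) (f x)) - (f^^k) (f x)\<bar>)"
      by (intro order_trans[OF sum_abs] sum_mono C)
    also have "\<dots> = n * (\<epsilon>/2) + C * \<bar>(f^^n) (f x) - f x\<bar>"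
      by (simp add: sum.distrib sum_distrib_left[symmetric] tele)
    also have "\<dots> \<le> n * (\<epsilon>/2) + C * 1"
      using in01[OF x, of 1] in01[of "f x" n] by (intro add_mono mult_left_mono C) auto
    finally have "\<bar>u (f x) - u x + \<psi> x\<bar> \<le> \<epsilon>/2 + C / n"
      using n unfolding eq by (simp add: field_simps)
    then show ?thesis using n by linarith
  qed
  ultimately show ?thesis by blast
qed

section \<open>Logarithmic bumps\<close>

text \<open>Changing the distance to \<open>p\<close> by a factor at most \<open>K\<close> shifts
  its logarithm by at most \<open>ln K\<close>. A bump that decays linearly in this logarithm with
  slope \<open>\<delta>\<close> therefore changes by at most \<open>\<delta> * ln K\<close>, however
  small its support.\<close>

lemma log_bump:
  fixes K r \<epsilon> p :: real
  assumes "K \<ge> 1" "r > 0" "\<epsilon> > 0"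
  shows "\<exists>w. continuous_on UNIV w \<and> w p = (1::real) \<and> (\<forall>x. \<bar>x - p\<bar> \<ge> r \<longrightarrow> w x = 0) \<and>
    (\<forall>x y. \<bar>y - p\<bar> \<le> K * \<bar>x - p\<bar> \<longrightarrow> \<bar>x - p\<bar> \<le> K * \<bar>y - p\<bar> \<longrightarrow> \<bar>w y - w x\<bar> < \<epsilon>)"
proof -
  \<comment> \<open>The summand 1 keeps the denominator positive when \<open>K = 1\<close>.\<close>
  define \<delta> where "\<delta> = \<epsilon> / (2 * (ln K + 1))"
  have lnK: "ln K \<ge> 0" using assms by simp
  have "ln K + 1 > 0" using lnK by (rule add_nonneg_pos) simp
  then have \<delta>: "\<delta> > 0" unfolding \<delta>_def using assms by (intro divide_pos_pos mult_pos_pos) simp_all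
  have small: "\<delta> * ln K < \<epsilon>"
  proof -
    have "\<delta> * ln K \<le> \<delta> * (ln K + 1)" using \<delta> by simp
    also have "\<dots> = \<epsilon>/2" using \<open>ln K + 1 > 0\<close> unfolding \<delta>_def by (simp add: divide_simps)
    finally show ?thesis using assms by simp
  qed
  \<comment> \<open>Chosen so that \<open>l = 1/\<delta>\<close> at distance \<open>r\<close>, where
    the bump reaches 0. Within distance \<open>s\<close> the logarithm is truncated and the bump
    equals 1.\<close>
  define s where "s = r / exp (1/\<delta>)"
  have s: "s > 0" using assms by (simp add: s_def)
  define l where "l x = ln (max 1 (\<bar>x - p\<bar> / s))" for x
  define w where "w x = max 0 (1 - \<delta> * l x)" for x
  have "continuous_on UNIV w"
    unfolding w_def l_def by (intro continuous_intros) (use s in auto)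
  moreover have "w p = 1" by (simp add: w_def l_def)
  moreover have "w x = 0" if "\<bar>x - p\<bar> \<ge> r" for x
  proof -
    have "exp (1/\<delta>) \<le> \<bar>x - p\<bar> / s"
      using that assms by (simp add: s_def field_simps)
    then have "1/\<delta> \<le> l x"
      unfolding l_def by (subst ln_ge_iff) auto
    then show ?thesis using \<delta> by (simp add: w_def field_simps)
  qed
  moreover have le: "l y \<le> ln K + l x" if "\<bar>y - p\<bar> \<le> K * \<bar>x - p\<bar>" for x y
  proof -
    have "\<bar>y - p\<bar> / s \<le> K * (\<bar>x - p\<bar> / s)"
      using that s by (simp add: field_simps)
    also have "\<dots> \<le> K * max 1 (\<bar>x - p\<bar> / s)"
      using assms by (intro mult_left_mono) auto
    moreover have "1 \<le> K * max 1 (\<bar>x - p\<bar> / s)"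
      using mult_mono[of 1 K 1 "max 1 (\<bar>x - p\<bar> / s)"] assms by auto
    ultimately have "max 1 (\<bar>y - p\<bar> / s) \<le> K * max 1 (\<bar>x - p\<bar> / s)" by simp
    then have "l y \<le> ln (K * max 1 (\<bar>x - p\<bar> / s))"
      unfolding l_def by (subst ln_le_cancel_iff) auto
    also have "\<dots> = ln K + l x"
      unfolding l_def using assms by (subst ln_mult) auto
    finally show ?thesis .
  qed
  have "\<bar>w y - w x\<bar> < \<epsilon>" if "\<bar>y - p\<bar> \<le> K * \<bar>x - p\<bar>" "\<bar>x - p\<bar> \<le> K * \<bar>y - p\<bar>" for x y
  proof -
    have "\<bar>\<delta> * l y - \<delta> * l x\<bar> = \<delta> * \<bar>l y - l x\<bar>"
      using \<delta> by (simp add: abs_mult right_diff_distrib[symmetric])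
    also have "\<dots> \<le> \<delta> * ln K"
      using le[OF that(1)] le[OF that(2)] \<delta> by (intro mult_left_mono) auto
    finally show ?thesis using small unfolding w_def by linarith
  qed
  ultimately show ?thesis by blast
qed

section \<open>Fundamental segments and propagation along orbits\<close>

text \<open>If \<open>p < f p\<close>, every point at or beyond \<open>p\<close> is carried to or
  beyond \<open>f p\<close> and stays there; the other direction is symmetric. Two versions are
  needed because consecutive translates of the segment share an endpoint, so openness must be
  required on one side.\<close>

lemma fundamental_segment_wandering:
  fixes f :: "real \<Rightarrow> real"
  assumes mono: "strict_mono f" and "f p \<noteq> p" and "k > 0"
  shows "x \<in> closed_segment p (f p) \<Longrightarrow> (f^^k) x \<notin> open_segment p (f p)"
    and "x \<in> open_segment p (f p) \<Longrightarrow> (f^^k) x \<notin> closed_segment p (f p)"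
proof -
  obtain j where j: "k = Suc j" using \<open>k > 0\<close> gr0_conv_Suc by blast
  note less = strict_mono_less[OF mono] strict_mono_less_eq[OF mono]
  have up: "f p \<le> (f^^k) x" "p < x \<Longrightarrow> f p < (f^^k) x" if "p < f p" "p \<le> x" for x
  proof -
    have "p \<le> (f^^i) x \<and> (p < x \<longrightarrow> p < (f^^i) x)" for i
    proof (induction i)
      case (Suc i)
      then have "f p \<le> (f^^Suc i) x" by (simp add: less)
      then show ?case using that by simp
    qed (use that in auto)
    then show "f p \<le> (f^^k) x" "p < x \<Longrightarrow> f p < (f^^k) x" by (auto simp: j less)
  qed
  have down: "f p \<ge> (f^^k) x" "p > x \<Longrightarrow> f p > (f^^k) x" if "p > f p" "p \<ge> x" for x
  proof -
    have "p \<ge> (f^^i) x \<and> (p > x \<longrightarrow> p > (f^^i) x)" for i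
    proof (induction i)
      case (Suc i)
      then have "f p \<ge> (f^^Suc i) x" by (simp add: less)
      then show ?case using that by simp
    qed (use that in auto)
    then show "f p \<ge> (f^^k) x" "p > x \<Longrightarrow> f p > (f^^k) x" by (auto simp: j less)
  qed
  show "x \<in> closed_segment p (f p) \<Longrightarrow> (f^^k) x \<notin> open_segment p (f p)"
    using up(1)[of x] down(1)[of x] \<open>f p \<noteq> p\<close>
    by (cases "p < f p") (auto simp: closed_segment_eq_real_ivl open_segment_eq_real_ivl)
  show "x \<in> open_segment p (f p) \<Longrightarrow> (f^^k) x \<notin> closed_segment p (f p)"
    using up(2)[of x] down(2)[of x] \<open>f p \<noteq> p\<close>
    by (cases "p < f p") (auto simp: closed_segment_eq_real_ivl open_segment_eq_real_ivl)
qed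

lemma fundamental_segment_not_fixed:
  fixes f :: "real \<Rightarrow> real"
  assumes "strict_mono f" "f p \<noteq> p" "x \<in> closed_segment p (f p)"
  shows "f x \<noteq> x"
proof
  assume fx: "f x = x"
  then have "x \<notin> open_segment p (f p)"
    using fundamental_segment_wandering(2)[OF assms(1,2), of 1 x] assms(3) by auto
  then have "x = p \<or> x = f p" using assms(3) by (auto simp: open_segment_def)
  then have "f p = p" using fx strict_mono_eq[OF assms(1)] by auto
  then show False using assms by simp
qed

text \<open>Abel summation, used to move the difference from the values along an orbit onto slowly
  varying coefficients.\<close>

lemma summation_by_parts:
  fixes c b :: "nat \<Rightarrow> real"
  shows "(\<Sum>k<n. c k * (b (Suc k) - b k)) = c n * b n - c 0 * b 0 - (\<Sum>k<n. (c (Suc k) - c k) * b (Suc k))"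
  by (induction n) (auto simp: algebra_simps)

text \<open>\<open>V\<close> is a weighted sum of the \<open>v \<circ> f^^j\<close> for
  \<open>j\<close> from \<open>-M\<close> to \<open>M-1\<close>. The translates of the open segment
  are disjoint, so each orbit meets at most one nonzero term, and applying \<open>f\<close> only
  replaces its weight by a neighbouring one, at distance at most \<open>1/M\<close>.\<close>

lemma spread_along_orbit:
  fixes f v :: "real \<Rightarrow> real"
  assumes mono: "strict_mono f" and cf: "continuous_on UNIV f" and "surj f"
    and cv: "continuous_on UNIV v" and p: "f p \<noteq> p"
    and v0: "\<And>x. x \<notin> open_segment p (f p) \<Longrightarrow> v x = 0" and "\<epsilon> > 0"
  shows "\<exists>V. continuous_on UNIV V \<and> (\<forall>x\<in>closed_segment p (f p). V x = v x) \<and>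
    (\<forall>x. f x = x \<longrightarrow> V x = 0) \<and> (\<forall>x. \<bar>V (f x) - V x\<bar> < \<epsilon>)"
proof -
  note wander = fundamental_segment_wandering[OF mono p]
  define g where "g = inv f"
  have injf: "inj f" using mono strict_mono_imp_inj_on by blast
  have fg: "f (g x) = x" for x unfolding g_def using \<open>surj f\<close> by (simp add: surj_f_inv_f)
  have gf: "g (f x) = x" for x unfolding g_def using injf by simp
  have "continuous_on (range f) g"
    unfolding g_def using cf injf
    by (intro continuous_on_inverse_open[where S=UNIV]) auto
  then have cg: "continuous_on UNIV g" using \<open>surj f\<close> by simp
  have fgM: "(f^^k) ((g^^k) x) = x" for k x
    by (induction k arbitrary: x) (auto simp: fg funpow_swap1)
  have fgM': "(f^^k) ((g^^M) x) = (g^^(M-k)) x" if "k \<le> M" for k M x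
    using fgM[of k "(g^^(M-k)) x"] that funpow_add[of k "M-k" g] by simp
  have fgM2: "(f^^k) ((g^^M) x) = (f^^(k-M)) x" if "M \<le> k" for k M x
    using fgM[of M x] that funpow_add[of "k-M" M f] by simp
  have commM: "(g^^M) (f x) = f ((g^^M) x)" for x M
    by (induction M) (auto simp: fg gf)
  obtain B where B: "B > 0" "\<And>x. \<bar>v x\<bar> \<le> B"
  proof -
    have "bounded (v ` closed_segment p (f p))"
      by (intro compact_imp_bounded compact_continuous_image continuous_on_subset[OF cv]) auto
    then obtain B where B: "B > 0" "\<And>x. x \<in> closed_segment p (f p) \<Longrightarrow> \<bar>v x\<bar> \<le> B"
      unfolding bounded_pos by auto
    show ?thesis
    proof (rule that[OF B(1)])
      show "\<bar>v x\<bar> \<le> B" for x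
        using B v0[of x] open_closed_segment[of x p "f p"] by (cases "x \<in> open_segment p (f p)") auto
    qed
  qed
  obtain M :: nat where M: "M > 0" "B / real M < \<epsilon>"
  proof -
    obtain n :: nat where "B / \<epsilon> < real n" using reals_Archimedean2 by blast
    moreover have "B / \<epsilon> > 0" using B \<open>\<epsilon> > 0\<close> by simp
    ultimately show ?thesis using that[of n] \<open>\<epsilon> > 0\<close>
      by (cases "n = 0") (simp_all add: field_simps)
  qed
  \<comment> \<open>A tent of slope \<open>1/M\<close>: its peak 1 at \<open>M\<close> preserves
    \<open>v\<close> on the segment, and its zeros at 0 and \<open>2*M\<close> remove the boundary
    terms of the Abel summation.\<close>
  define c where "c k = 1 - \<bar>real k - real M\<bar> / real M" for k
  have c0: "c 0 = 0" "c (2*M) = 0" "c M = 1" using M by (auto simp: c_def)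
  have cdiff: "\<bar>c (Suc k) - c k\<bar> \<le> 1 / real M" for k
  proof -
    have "c (Suc k) - c k = (\<bar>real k - real M\<bar> - \<bar>real (Suc k) - real M\<bar>) / real M"
      by (simp add: c_def diff_divide_distrib)
    moreover have "\<bar>\<bar>real k - real M\<bar> - \<bar>real (Suc k) - real M\<bar>\<bar> \<le> 1" by simp
    ultimately show ?thesis using M by (simp add: abs_divide divide_right_mono)
  qed
  define W where "W y = (\<Sum>k<2*M. c k * v ((f^^k) y))" for y
  \<comment> \<open>Starting \<open>M\<close> steps back places the untranslated copy of
    \<open>v\<close> at index \<open>M\<close>, under the peak of the tent.\<close>
  define V where "V x = W ((g^^M) x)" for x
  have "continuous_on UNIV W"
    unfolding W_def by (intro continuous_intros continuous_on_compose2[OF cv continuous_on_funpow[OF cf]]) auto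
  then have "continuous_on UNIV V"
    unfolding V_def by (rule continuous_on_compose2[OF _ continuous_on_funpow[OF cg]]) auto
  moreover have "V x = v x" if x: "x \<in> closed_segment p (f p)" for x
  proof -
    \<comment> \<open>For \<open>k < M\<close> a backward iterate inside the open segment would
      return to \<open>x\<close> in the closed one; for \<open>k > M\<close> a forward iterate of
      \<open>x\<close> would re-enter the open segment. Wandering excludes both.\<close>
    have z: "v ((f^^k) ((g^^M) x)) = 0" if "k \<noteq> M" for k
    proof (cases "k < M")
      case True
      have "(g^^(M-k)) x \<notin> open_segment p (f p)"
        using wander(2)[of "M-k" "(g^^(M-k)) x"] fgM[of "M-k" x] True x by auto
      then show ?thesis using fgM'[of k M x] True v0 by simp
    next
      case False
      then have "(f^^(k-M)) x \<notin> open_segment p (f p)"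
        using wander(1)[of "k-M" x] that x by simp
      then show ?thesis using fgM2[of M k x] False v0 by simp
    qed
    have "V x = (\<Sum>k<2*M. if k = M then v x else 0)"
      unfolding V_def W_def by (intro sum.cong) (auto simp: z c0 fgM)
    then show ?thesis using M by simp
  qed
  moreover have "V x = 0" if "f x = x" for x
  proof -
    have "g x = x" using gf[of x] that by simp
    then have "(g^^k) x = x" "(f^^k) x = x" for k by (induction k) (use that in auto)
    moreover have "x \<notin> open_segment p (f p)"
      using fundamental_segment_not_fixed[OF mono p] that open_closed_segment by blast
    ultimately show ?thesis by (simp add: V_def W_def v0)
  qed
  moreover have "\<bar>V (f x) - V x\<bar> < \<epsilon>" for x
  proof -
    define y where "y = (g^^M) x"
    define b where "b k = v ((f^^k) y)" for k
    \<comment> \<open>Two nonzero values would be two visits of one orbit to the open segment. Hence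
      the sum of the \<open>\<bar>b (Suc k)\<bar>\<close> is bounded by \<open>B\<close>,
      independently of \<open>M\<close>.\<close>
    have uniq: "i = j" if "b i \<noteq> 0" "b j \<noteq> 0" "i \<le> j" for i j
    proof (rule ccontr)
      assume "i \<noteq> j"
      then have "(f^^(j-i)) ((f^^i) y) \<notin> closed_segment p (f p)"
        using wander(2)[of "j-i" "(f^^i) y"] that v0[of "(f^^i) y"] by (auto simp: b_def)
      moreover have "(f^^(j-i)) ((f^^i) y) = (f^^j) y"
        using that funpow_add[of "j-i" i f] by simp
      ultimately show False using that v0[of "(f^^j) y"] open_closed_segment by (auto simp: b_def)
    qed
    have sumb: "(\<Sum>k<n. \<bar>b (Suc k)\<bar>) \<le> B" for n
    proof (cases "\<exists>j<n. b (Suc j) \<noteq> 0")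
      case True
      then obtain j where j: "j < n" "b (Suc j) \<noteq> 0" by blast
      have "b (Suc k) = 0" if "k \<noteq> j" for k
        using uniq[of "Suc j" "Suc k"] uniq[of "Suc k" "Suc j"] that j by (cases "j \<le> k") auto
      then have "(\<Sum>k<n. \<bar>b (Suc k)\<bar>) = (\<Sum>k<n. if k = j then \<bar>b (Suc j)\<bar> else 0)"
        by (intro sum.cong) auto
      then show ?thesis using j B by (simp add: b_def)
    next
      case False
      then show ?thesis using B by simp
    qed
    have "W (f y) - W y = (\<Sum>k<2*M. c k * (b (Suc k) - b k))"
      unfolding W_def b_def
      by (simp add: sum_subtractf[symmetric] right_diff_distrib funpow_swap1)
    also have "\<dots> = - (\<Sum>k<2*M. (c (Suc k) - c k) * b (Suc k))"
      by (subst summation_by_parts) (simp add: c0)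
    finally have "\<bar>W (f y) - W y\<bar> = \<bar>\<Sum>k<2*M. (c (Suc k) - c k) * b (Suc k)\<bar>" by simp
    also have "\<dots> \<le> (\<Sum>k<2*M. 1 / real M * \<bar>b (Suc k)\<bar>)"
      by (intro order_trans[OF sum_abs] sum_mono, unfold abs_mult) (intro mult_right_mono cdiff abs_ge_zero)
    also have "\<dots> \<le> 1 / real M * B"
      unfolding sum_distrib_left[symmetric] by (intro mult_left_mono sumb) auto
    finally show ?thesis using M by (simp add: V_def y_def commM)
  qed
  ultimately show ?thesis by blast
qed

section \<open>Gluing the solutions for a finite family\<close>

text \<open>The cut function is \<open>v\<close> after clamping to the segment: points outside go to
  an endpoint, where \<open>v\<close> vanishes.\<close>

lemma continuous_on_cut_to_segment:
  fixes v :: "real \<Rightarrow> real"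
  assumes "continuous_on UNIV v" "v a = 0" "v b = 0"
  shows "continuous_on UNIV (\<lambda>x. if x \<in> closed_segment a b then v x else 0)"
proof -
  have "(\<lambda>x. if x \<in> closed_segment a b then v x else 0) =
      (\<lambda>x. v (max (min a b) (min (max a b) x)))"
    using assms by (auto simp: fun_eq_iff closed_segment_eq_real_ivl max_def min_def)
  moreover have "continuous_on UNIV (\<lambda>x. v (max (min a b) (min (max a b) x)))"
    by (intro continuous_on_compose2[OF assms(1)] continuous_intros) auto
  ultimately show ?thesis by metis
qed

text \<open>Induction by increasing length of the fundamental segments, so the inserted
  \<open>m\<close> has a longest one. Vanishing at common fixed points is carried along because it
  makes \<open>u1\<close> zero at the ends of \<open>J\<close> and wherever \<open>A\<close> acts
  trivially, which is what lets the pieces be glued. The hypothesis \<open>lip\<close> supplies the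
  distortion constant for the logarithmic bumps.\<close>

lemma finite_family_log_density:
  fixes f \<psi> :: "'i \<Rightarrow> real \<Rightarrow> real" and p :: "'i \<Rightarrow> real"
  assumes mono: "\<And>i. strict_mono (f i)" and cf: "\<And>i. continuous_on UNIV (f i)"
    and surj: "\<And>i. surj (f i)" and out: "\<And>i x. x \<notin> {0..1} \<Longrightarrow> f i x = x"
    and c\<psi>: "\<And>i. continuous_on UNIV (\<psi> i)" and fix0: "\<And>i x. f i x = x \<Longrightarrow> \<psi> i x = 0"
    and lip: "\<And>i. \<exists>K\<ge>1. \<forall>z\<in>{0..1}. f i z = z \<longrightarrow>
      (\<forall>x. \<bar>f i x - z\<bar> \<le> K * \<bar>x - z\<bar> \<and> \<bar>x - z\<bar> \<le> K * \<bar>f i x - z\<bar>)"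
    and p: "\<And>i. f i (p i) \<noteq> p i"
    and nested: "\<And>i j. i \<noteq> j \<Longrightarrow>
      {x. f i x \<noteq> x} \<subseteq> open_segment (p j) (f j (p j)) \<or>
      {x. f j x \<noteq> x} \<subseteq> open_segment (p i) (f i (p i)) \<or>
      {x. f i x \<noteq> x} \<inter> {x. f j x \<noteq> x} = {}"
    and "finite A" "\<epsilon> > 0"
  shows "\<exists>u. continuous_on UNIV u \<and> (\<forall>x. (\<forall>i\<in>A. f i x = x) \<longrightarrow> u x = 0) \<and>
    (\<forall>i\<in>A. \<forall>x. \<bar>u (f i x) - u x + \<psi> i x\<bar> < \<epsilon>)"
  using \<open>finite A\<close> \<open>\<epsilon> > 0\<close>
proof (induction A arbitrary: \<epsilon> rule: finite_ranking_induct[where f = "\<lambda>i. \<bar>f i (p i) - p i\<bar>"])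
  case empty
  show ?case by (intro exI[of _ "\<lambda>_. 0"]) auto
next
  case (insert m A)
  show ?case
  proof (cases "m \<in> A")
    case True
    then show ?thesis using insert by (simp add: insert_absorb)
  next
    case False
    define a where "a = p m"
    define b where "b = f m a"
    define J where "J = closed_segment a b"
    have ab: "a \<noteq> b" using p[of m] by (simp add: a_def b_def)
    have Jm: "f m x \<noteq> x" if "x \<in> J" for x
      using fundamental_segment_not_fixed[OF mono p, of x m] that by (simp add: J_def a_def b_def)
    have abJ: "a \<in> J" "b \<in> J" by (auto simp: J_def)
    have ab01: "a \<in> {0..1}" "b \<in> {0..1}" using out[of _ m] Jm abJ by blast+
    have moved: "f i (f i x) \<noteq> f i x" if "f i x \<noteq> x" for i x
      using that strict_mono_eq[OF mono] by blast
    \<comment> \<open>The excluded case puts both ends of \<open>J\<close> strictly inside the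
      segment of \<open>j\<close>, which would then be longer than \<open>J\<close>.\<close>
    have dich: "{x. f j x \<noteq> x} \<subseteq> open_segment a b \<or> {x. f j x \<noteq> x} \<inter> {x. f m x \<noteq> x} = {}"
      if "j \<in> A" for j
    proof (rule ccontr)
      assume "\<not> ?thesis"
      then have sub: "{x. f m x \<noteq> x} \<subseteq> open_segment (p j) (f j (p j))"
        using nested[of j m] that False by (auto simp: a_def b_def)
      have "a \<in> open_segment (p j) (f j (p j))" "b \<in> open_segment (p j) (f j (p j))"
        using sub Jm abJ by auto
      then have "\<bar>b - a\<bar> < \<bar>f j (p j) - p j\<bar>"
        by (auto simp: open_segment_eq_real_ivl split: if_splits)
      then show False using insert.hyps(2)[OF that] by (simp add: a_def b_def)
    qed
    have fixab: "f j a = a" "f j b = b" if "j \<in> A" for j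
      using dich[OF that] Jm abJ by (auto simp: open_segment_def)
    obtain u1 where u1: "continuous_on UNIV u1" "\<And>x. (\<forall>i\<in>A. f i x = x) \<Longrightarrow> u1 x = 0"
        "\<And>i x. i \<in> A \<Longrightarrow> \<bar>u1 (f i x) - u1 x + \<psi> i x\<bar> < \<epsilon>/2"
      using insert.IH[of "\<epsilon>/2"] insert.prems by auto
    obtain um where um: "continuous_on UNIV um" "\<And>x. f m x = x \<Longrightarrow> um x = 0"
        "\<And>x. \<bar>um (f m x) - um x + \<psi> m x\<bar> < \<epsilon>/2"
      using averaged_coboundary[OF mono[of m] cf[of m] out[of _ m] c\<psi>[of m] fix0[of m], of "\<epsilon>/2"] insert.prems by auto
    have u1ab: "u1 a = 0" "u1 b = 0" using u1(2) fixab by auto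
    obtain K where K: "K \<ge> 1" "\<And>j z x. j \<in> A \<Longrightarrow> z \<in> {0..1} \<Longrightarrow> f j z = z \<Longrightarrow>
        \<bar>f j x - z\<bar> \<le> K * \<bar>x - z\<bar> \<and> \<bar>x - z\<bar> \<le> K * \<bar>f j x - z\<bar>"
    proof -
      obtain k where k: "\<And>i. k i \<ge> 1" "\<And>i z x. z \<in> {0..1} \<Longrightarrow> f i z = z \<Longrightarrow>
        \<bar>f i x - z\<bar> \<le> k i * \<bar>x - z\<bar> \<and> \<bar>x - z\<bar> \<le> k i * \<bar>f i x - z\<bar>"
        using lip by metis
      have kpos: "k i \<ge> 0" for i using k(1)[of i] by simp
      have le: "k j \<le> 1 + sum k A" if "j \<in> A" for j
        using member_le_sum[OF that, of k] kpos insert.hyps(1) by fastforce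
      show ?thesis
      proof (rule that)
        show "1 \<le> 1 + sum k A" using kpos by (simp add: sum_nonneg)
        fix j z x assume *: "j \<in> A" "z \<in> {0..1}" "f j z = z"
        have "k j * \<bar>y\<bar> \<le> (1 + sum k A) * \<bar>y\<bar>" for y
          using le[OF *(1)] by (intro mult_right_mono) auto
        then show "\<bar>f j x - z\<bar> \<le> (1 + sum k A) * \<bar>x - z\<bar> \<and> \<bar>x - z\<bar> \<le> (1 + sum k A) * \<bar>f j x - z\<bar>"
          using k(2)[OF *(2,3), of x] by (meson order_trans)
      qed
    qed
    \<comment> \<open>Small enough that bumps of heights \<open>um a\<close> and \<open>um b\<close>
      together cost at most \<open>\<epsilon>/2\<close>; the summand 1 avoids division by
      zero.\<close>
    define \<eta> where "\<eta> = \<epsilon> / (2 * (1 + \<bar>um a\<bar> + \<bar>um b\<bar>))"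
    have \<eta>: "\<eta> > 0" unfolding \<eta>_def using insert.prems by (intro divide_pos_pos) auto
    have \<eta>': "(\<bar>um a\<bar> + \<bar>um b\<bar>) * \<eta> \<le> \<epsilon>/2"
    proof -
      have "(\<bar>um a\<bar> + \<bar>um b\<bar>) * \<eta> \<le> (1 + \<bar>um a\<bar> + \<bar>um b\<bar>) * \<eta>"
        using \<eta> by (intro mult_right_mono) auto
      also have "\<dots> = \<epsilon>/2"
        unfolding \<eta>_def using abs_ge_zero[of "um a"] abs_ge_zero[of "um b"]
        by (simp add: field_simps)
      finally show ?thesis .
    qed
    have r: "\<bar>b - a\<bar> > 0" using ab by simp
    \<comment> \<open>Radius \<open>\<bar>b - a\<bar>\<close> makes the bump at one end of
      \<open>J\<close> vanish at the other. Both ends are fixed by all of \<open>A\<close>, so each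
      map in \<open>A\<close> distorts distances to them by at most \<open>K\<close>.\<close>
    obtain wa where wa: "continuous_on UNIV wa" "wa a = 1" "wa b = 0"
        "\<And>j x. j \<in> A \<Longrightarrow> \<bar>wa (f j x) - wa x\<bar> < \<eta>"
      using log_bump[OF K(1) r \<eta>, of a] K(2) ab01 fixab by (metis order_refl)
    obtain wb where wb: "continuous_on UNIV wb" "wb b = 1" "wb a = 0"
        "\<And>j x. j \<in> A \<Longrightarrow> \<bar>wb (f j x) - wb x\<bar> < \<eta>"
      using log_bump[OF K(1) r \<eta>, of b] K(2) ab01 fixab by (metis order_refl abs_minus_commute)
    \<comment> \<open>Takes the values of \<open>um\<close> at \<open>a\<close> and
      \<open>b\<close>, so that the correction \<open>v\<close> vanishes at both ends of
      \<open>J\<close>.\<close>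
    define w where "w x = um a * wa x + um b * wb x" for x
    have cw: "continuous_on UNIV w"
      unfolding w_def by (intro continuous_intros wa wb)
    have winv: "\<bar>w (f j x) - w x\<bar> \<le> \<epsilon>/2" if "j \<in> A" for j x
    proof -
      have "w (f j x) - w x = um a * (wa (f j x) - wa x) + um b * (wb (f j x) - wb x)"
        by (simp add: w_def algebra_simps)
      also have "\<bar>\<dots>\<bar> \<le> \<bar>um a\<bar> * \<bar>wa (f j x) - wa x\<bar> + \<bar>um b\<bar> * \<bar>wb (f j x) - wb x\<bar>"
        by (rule order_trans[OF abs_triangle_ineq]) (simp add: abs_mult)
      also have "\<dots> \<le> \<bar>um a\<bar> * \<eta> + \<bar>um b\<bar> * \<eta>"
        using wa(4)[OF that, of x] wb(4)[OF that, of x] by (intro add_mono mult_left_mono) auto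
      finally show ?thesis using \<eta>' by (simp add: algebra_simps)
    qed
    define v where "v x = (if x \<in> J then u1 x + w x - um x else 0)" for x
    have cv: "continuous_on UNIV v"
      unfolding v_def J_def
      by (rule continuous_on_cut_to_segment[where v = "\<lambda>x. u1 x + w x - um x"],
          intro continuous_intros u1 um cw) (simp_all add: w_def wa wb u1ab)
    have "v x = 0" if "x \<notin> open_segment (p m) (f m (p m))" for x
      using that by (auto simp: v_def J_def a_def[symmetric] b_def[symmetric] open_segment_def w_def
          wa wb u1ab)
    then obtain V where V: "continuous_on UNIV V" "\<And>x. x \<in> J \<Longrightarrow> V x = v x"
        "\<And>x. f m x = x \<Longrightarrow> V x = 0" "\<And>x. \<bar>V (f m x) - V x\<bar> < \<epsilon>/2"
      using spread_along_orbit[OF mono cf surj cv p[of m], of "\<epsilon>/2"] insert.prems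
      unfolding J_def a_def b_def by auto
    \<comment> \<open>On \<open>J\<close> this is \<open>u1 + w\<close>, which suits the maps
      supported there. Off \<open>J\<close> it is \<open>um + V + u1\<close>, which reduces to
      \<open>um + V\<close> where \<open>f m\<close> moves points and to \<open>u1\<close> where
      \<open>f m\<close> fixes them.\<close>
    define u where "u x = um x + V x + (u1 x - (if x \<in> closed_segment a b then u1 x else 0))" for x
    have "continuous_on UNIV u"
      unfolding u_def
      by (intro continuous_intros um V u1 continuous_on_cut_to_segment[OF u1(1) u1ab])
    moreover have "u x = 0" if "\<forall>i\<in>insert m A. f i x = x" for x
      using that um(2) V(3) u1(2) by (simp add: u_def)
    moreover have "\<bar>u (f i x) - u x + \<psi> i x\<bar> < \<epsilon>" if "i \<in> insert m A" for i x
    proof (cases "f i x = x")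
      case True
      then show ?thesis using fix0[OF True] insert.prems by simp
    next
      case nf: False
      show ?thesis
      proof (cases "i = m")
        case True
        \<comment> \<open>Off \<open>J\<close>, a point moved by \<open>f m\<close> is fixed by all
          of \<open>A\<close>, so \<open>u1\<close> vanishes there.\<close>
        have *: "u y = um y + V y" if "f m y \<noteq> y" for y
        proof (cases "y \<in> J")
          case False
          have "f j y = y" if "j \<in> A" for j
            using dich[OF that] False \<open>f m y \<noteq> y\<close> by (auto simp: J_def open_segment_def)
          then show ?thesis using u1(2) by (simp add: u_def)
        qed (simp add: u_def J_def)
        have "u (f m x) - u x + \<psi> m x = (um (f m x) - um x + \<psi> m x) + (V (f m x) - V x)"
          using *[of x] *[of "f m x"] moved nf True by simp
        then show ?thesis using um(3)[of x] V(4)[of x] unfolding \<open>i = m\<close> by linarith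
      next
        case False
        then have i: "i \<in> A" using that by simp
        have N: "f i (f i x) \<noteq> f i x" using moved nf by simp
        consider "{x. f i x \<noteq> x} \<subseteq> open_segment a b" | "{x. f i x \<noteq> x} \<inter> {x. f m x \<noteq> x} = {}"
          using dich[OF i] by blast
        then show ?thesis
        proof cases
          case 1
          have *: "u y = u1 y + w y" if "f i y \<noteq> y" for y
            using 1 that V(2)[of y] by (auto simp: u_def v_def J_def open_segment_def)
          have "u (f i x) - u x + \<psi> i x = (u1 (f i x) - u1 x + \<psi> i x) + (w (f i x) - w x)"
            using *[OF nf] *[OF N] by simp
          then show ?thesis using u1(3)[OF i, of x] winv[OF i, of x] by linarith
        next
          case 2
          have *: "u y = u1 y" if "f i y \<noteq> y" for y
          proof -
            have "f m y = y" using 2 that by auto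
            moreover from this have "y \<notin> closed_segment a b" using Jm by (auto simp: J_def)
            ultimately show ?thesis using um(2) V(3) by (simp add: u_def)
          qed
          have "u (f i x) - u x + \<psi> i x = u1 (f i x) - u1 x + \<psi> i x"
            using *[OF nf] *[OF N] by simp
          then show ?thesis using u1(3)[OF i, of x] insert.prems by linarith
        qed
      qed
    qed
    ultimately show ?thesis by blast
  qed
qed

section \<open>Derivatives on the unit interval and log-densities\<close>

lemma has_real_derivative_inverse_within:
  fixes f g :: "real \<Rightarrow> real"
  assumes "(f has_real_derivative d) (at x within S)" "d \<noteq> 0" "compact S" "x \<in> S"
    and "continuous_on S f" "f ` S = T" "\<And>x. x \<in> S \<Longrightarrow> g (f x) = x"
  shows "(g has_real_derivative 1/d) (at (f x) within T)"
proof -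
  have "continuous_on (f ` S) g"
    using assms by (intro continuous_on_inv) auto
  then have "continuous (at (f x) within f ` S) g"
    using \<open>x \<in> S\<close> unfolding continuous_on_eq_continuous_within by blast
  then have "(g has_derivative (\<lambda>y. y / d)) (at (f x) within f ` S)"
    using assms
    by (intro has_derivative_inverse_within[where f' = "\<lambda>y. d * y"])
      (auto simp: has_field_derivative_def fun_eq_iff intro: bounded_linear.linear bounded_linear_divide)
  moreover have "(\<lambda>y. y / d) = (*) (1/d)" by auto
  ultimately show ?thesis using assms by (simp add: has_field_derivative_def)
qed

lemma mean_value_unit_interval:
  fixes f D :: "real \<Rightarrow> real"
  assumes "\<And>x. x \<in> {0..1} \<Longrightarrow> (f has_real_derivative D x) (at x within {0..1})"
    and "x \<in> {0..1}" "y \<in> {0..1}"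
  shows "\<exists>z\<in>{0..1}. f y - f x = D z * (y - x)"
proof -
  have *: "\<exists>z\<in>{0..1}. f b - f a = D z * (b - a)" if "0 \<le> a" "a \<le> b" "b \<le> 1" for a b
  proof -
    have "\<exists>z\<in>{a..b}. f b - f a = (*) (D z) (b - a)"
      using that
      by (intro mvt_very_simple)
        (auto simp: has_field_derivative_def[symmetric] intro!: DERIV_subset[OF assms(1)])
    then show ?thesis using that by auto
  qed
  show ?thesis
  proof (cases "x \<le> y")
    case True
    then show ?thesis using *[of x y] assms by simp
  next
    case False
    then obtain z where "z \<in> {0..1}" "f x - f y = D z * (x - y)" using *[of y x] assms by auto
    then have "f y - f x = D z * (y - x)" by (simp add: algebra_simps)
    then show ?thesis using \<open>z \<in> {0..1}\<close> by blast
  qed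
qed

lemma d1_eqI:
  assumes "(f has_real_derivative d) (at x within {0..1})" "x \<in> {0..1}"
  shows "d1 f x = d"
proof -
  have "e = d" if "(f has_real_derivative e) (at x within {0..1})" for e
    using vector_derivative_unique_within_closed_interval[of 0 1 x f e d] assms that
    by (simp add: has_real_derivative_iff_has_vector_derivative)
  then show ?thesis unfolding d1_def using assms(1) by blast
qed

lemma diff1pD:
  assumes "diff1p f"
  shows "strict_mono f" "surj f" "continuous_on {0..1} f" "f ` {0..1} = {0..1}" "f 0 = 0" "f 1 = 1"
    "x \<notin> {0..1} \<Longrightarrow> f x = x" "inv f ` {0..1} = {0..1}" "inv f 0 = 0"
proof -
  have bij: "bij_betw f {0..1} {0..1}" and out: "\<And>x. x \<notin> {0..1} \<Longrightarrow> f x = x"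
    and m: "mono_on {0..1} f"
    using assms by (auto simp: diff1p_def)
  show im: "f ` {0..1} = {0..1}" using bij by (simp add: bij_betw_def)
  show sm: "strict_mono f"
  proof
    fix x y :: real assume "x < y"
    have *: "f z \<in> {0..1}" if "z \<in> {0..1}" for z using im that by blast
    consider "x \<in> {0..1}" "y \<in> {0..1}" | "x \<notin> {0..1}" "y \<in> {0..1}" | "x \<in> {0..1}" "y \<notin> {0..1}"
      | "x \<notin> {0..1}" "y \<notin> {0..1}" by blast
    then show "f x < f y"
    proof cases
      case 1
      then have "f x \<le> f y" using m \<open>x < y\<close> by (auto simp: monotone_on_def)
      moreover have "f x \<noteq> f y"
        using bij_betw_imp_inj_on[OF bij] 1 \<open>x < y\<close> by (metis inj_onD less_irrefl)
      ultimately show ?thesis by simp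
    next
      case 2 then show ?thesis using *[of y] out[of x] \<open>x < y\<close> by auto
    next
      case 3 then show ?thesis using *[of x] out[of y] \<open>x < y\<close> by auto
    next
      case 4 then show ?thesis using out \<open>x < y\<close> by auto
    qed
  qed
  show "surj f"
    unfolding surj_def
  proof
    show "\<exists>x. y = f x" for y
    proof (cases "y \<in> {0..1}")
      case True
      then show ?thesis using im by (metis imageE)
    qed (use out in metis)
  qed
  show "continuous_on {0..1} f"
  proof -
    obtain D where "\<And>x. x \<in> {0..1} \<Longrightarrow> (f has_real_derivative D x) (at x within {0..1})"
      using assms unfolding diff1p_def by blast
    then show ?thesis by (rule DERIV_continuous_on)
  qed
  have "0 \<in> f ` {0..1}" "1 \<in> f ` {0..1}" using im by auto
  then obtain a b where ab: "a \<in> {0..1}" "f a = 0" "b \<in> {0..1}" "f b = 1"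
    unfolding image_iff by metis
  have "f 0 \<le> f a" "f b \<le> f 1" using ab strict_mono_less_eq[OF sm, of 0 a] strict_mono_less_eq[OF sm, of b 1] by auto
  moreover have "f 0 \<in> {0..1}" "f 1 \<in> {0..1}" using im by auto
  ultimately show f01: "f 0 = 0" "f 1 = 1" using ab by auto
  show "x \<notin> {0..1} \<Longrightarrow> f x = x" by (rule out)
  have inj: "inj f" using sm strict_mono_imp_inj_on by blast
  show "inv f ` {0..1} = {0..1}"
    using image_inv_f_f[OF inj, of "{0..1}"] im by simp
  show "inv f 0 = 0" using inj f01 by (metis inv_f_f)
qed

lemma diff1p_log_derivative:
  assumes "diff1p f" "no_hyperbolic_fixed_points f"
  shows "continuous_on UNIV f"
    and "\<exists>\<psi>. continuous_on UNIV \<psi> \<and> (\<forall>x. f x = x \<longrightarrow> \<psi> x = 0) \<and>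
      (\<forall>x\<in>{0..1}. (f has_real_derivative exp (\<psi> x)) (at x within {0..1}))"
proof -
  note f = diff1pD[OF assms(1)]
  define c :: "real \<Rightarrow> real" where "c x = max 0 (min 1 x)" for x
  have cc: "continuous_on UNIV c" unfolding c_def by (intro continuous_intros)
  have c01: "c x \<in> {0..1}" for x by (auto simp: c_def)
  have cid: "c x = x" if "x \<in> {0..1}" for x using that by (auto simp: c_def)
  have cout: "c x = 0 \<or> c x = 1" if "x \<notin> {0..1}" for x using that by (auto simp: c_def)
  \<comment> \<open>\<open>c\<close> clamps to [0,1]; since \<open>f\<close> fixes 0 and 1, this
    formula agrees with the identity outside.\<close>
  have "f x = f (c x) + (x - c x)" for x
    using cid[of x] cout[of x] f(5,6) f(7)[of x] by (cases "x \<in> {0..1}") auto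
  then have "f = (\<lambda>x. f (c x) + (x - c x))" by blast
  moreover have "continuous_on UNIV (\<lambda>x. f (c x) + (x - c x))"
    by (intro continuous_intros continuous_on_compose2[OF f(3) cc] cc) (use c01 in auto)
  ultimately show "continuous_on UNIV f" by metis
  obtain D where D: "continuous_on {0..1} D"
      "\<And>x. x \<in> {0..1} \<Longrightarrow> (f has_real_derivative D x) (at x within {0..1})"
      "\<And>x. x \<in> {0..1} \<Longrightarrow> D x > 0"
    using assms(1) unfolding diff1p_def by blast
  have D1: "D x = 1" if "x \<in> {0..1}" "f x = x" for x
    using d1_eqI[OF D(2)[OF that(1)] that(1)] d1_eqI[of f 1 x] assms(2) that
    by (auto simp: no_hyperbolic_fixed_points_def)
  \<comment> \<open>Clamping makes \<open>\<psi>\<close> constant beyond each endpoint. The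
    endpoints are fixed points, so the derivative there is 1 and \<open>\<psi>\<close> is 0 outside
    [0,1].\<close>
  define \<psi> where "\<psi> x = ln (D (c x))" for x
  have "continuous_on UNIV (\<lambda>x. D (c x))"
    by (intro continuous_on_compose2[OF D(1) cc]) (use c01 in auto)
  then have "continuous_on UNIV \<psi>"
    unfolding \<psi>_def using D(3)[OF c01] by (intro continuous_on_ln) (auto simp: less_le)
  moreover have "\<psi> x = 0" if "f x = x" for x
    using D1[of "c x"] c01[of x] cid[of x] cout[of x] f(5,6) that
    by (cases "x \<in> {0..1}") (auto simp: \<psi>_def)
  moreover have "(f has_real_derivative exp (\<psi> x)) (at x within {0..1})" if "x \<in> {0..1}" for x
    using D(2,3)[OF that] by (simp add: \<psi>_def cid[OF that])
  ultimately show "\<exists>\<psi>. continuous_on UNIV \<psi> \<and> (\<forall>x. f x = x \<longrightarrow> \<psi> x = 0) \<and>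
      (\<forall>x\<in>{0..1}. (f has_real_derivative exp (\<psi> x)) (at x within {0..1}))" by blast
qed

text \<open>By the mean value theorem distances to a fixed point are scaled by some
  \<open>exp (\<psi> t)\<close>, which lies between \<open>exp (- B)\<close> and
  \<open>exp B\<close>. This is the distortion bound that the logarithmic bumps require.\<close>

lemma bilipschitz_at_fixed_points:
  fixes f \<psi> :: "real \<Rightarrow> real"
  assumes out: "\<And>x. x \<notin> {0..1} \<Longrightarrow> f x = x" and c\<psi>: "continuous_on UNIV \<psi>"
    and der: "\<And>x. x \<in> {0..1} \<Longrightarrow> (f has_real_derivative exp (\<psi> x)) (at x within {0..1})"
  shows "\<exists>K\<ge>1. \<forall>z\<in>{0..1}. f z = z \<longrightarrow>
      (\<forall>x. \<bar>f x - z\<bar> \<le> K * \<bar>x - z\<bar> \<and> \<bar>x - z\<bar> \<le> K * \<bar>f x - z\<bar>)"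
proof -
  have "bounded (\<psi> ` {0..1})"
    by (intro compact_imp_bounded compact_continuous_image continuous_on_subset[OF c\<psi>]) auto
  then obtain B where B: "B > 0" "\<And>x. x \<in> {0..1} \<Longrightarrow> \<bar>\<psi> x\<bar> \<le> B"
    unfolding bounded_pos by auto
  have "\<bar>f x - z\<bar> \<le> exp B * \<bar>x - z\<bar> \<and> \<bar>x - z\<bar> \<le> exp B * \<bar>f x - z\<bar>"
    if z: "z \<in> {0..1}" "f z = z" for x z
  proof (cases "x \<in> {0..1}")
    case True
    then obtain t where t: "t \<in> {0..1}" "f x - f z = exp (\<psi> t) * (x - z)"
      using mean_value_unit_interval[OF der z(1) True] by blast
    have eq: "\<bar>f x - z\<bar> = exp (\<psi> t) * \<bar>x - z\<bar>" using t z by (simp add: abs_mult)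
    have "\<bar>x - z\<bar> = exp (- \<psi> t) * \<bar>f x - z\<bar>" unfolding eq by (simp add: exp_minus)
    also have "\<dots> \<le> exp B * \<bar>f x - z\<bar>"
      using B(2)[OF t(1)] by (intro mult_right_mono) auto
    finally have "\<bar>x - z\<bar> \<le> exp B * \<bar>f x - z\<bar>" .
    moreover have "\<bar>f x - z\<bar> \<le> exp B * \<bar>x - z\<bar>"
      unfolding eq using B(2)[OF t(1)] by (intro mult_right_mono) auto
    ultimately show ?thesis by blast
  next
    case False
    have "1 * \<bar>x - z\<bar> \<le> exp B * \<bar>x - z\<bar>" using B by (intro mult_right_mono) auto
    then show ?thesis using out[OF False] by simp
  qed
  moreover have "exp B \<ge> 1" using B by simp
  ultimately show ?thesis by blast
qed

text \<open>\<open>h\<close> is the antiderivative of \<open>exp u\<close>, normalised to map [0,1]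
  onto itself; the normalisation shifts the log-density by \<open>c = - ln L\<close>.\<close>

lemma diff1p_of_log_density:
  fixes u :: "real \<Rightarrow> real"
  assumes "continuous_on UNIV u"
  shows "\<exists>h c. diff1p h \<and> (\<forall>x\<in>{0..1}. (h has_real_derivative exp (u x + c)) (at x within {0..1}))"
proof -
  have "continuous_on {0..1} (\<lambda>x. exp (u x))"
    by (intro continuous_intros continuous_on_subset[OF assms]) auto
  then obtain E where E: "\<And>x. x \<in> {0..1} \<Longrightarrow> (E has_vector_derivative exp (u x)) (at x within {0..1})"
    using antiderivative_continuous by blast
  then have dE: "(E has_real_derivative exp (u x)) (at x within {0..1})" if "x \<in> {0..1}" for x
    using that by (simp add: has_real_derivative_iff_has_vector_derivative)
  define L where "L = E 1 - E 0"
  have "\<exists>z. L = exp (u z)" using mean_value_unit_interval[OF dE, of 0 1] by (auto simp: L_def)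
  then have L: "L > 0" by auto
  define k where "k x = (E x - E 0) / L" for x
  define h where "h x = (if x \<in> {0..1} then k x else x)" for x
  define c where "c = - ln L"
  have dk: "(k has_real_derivative exp (u x + c)) (at x within {0..1})" if "x \<in> {0..1}" for x
  proof -
    have "(k has_real_derivative exp (u x) / L) (at x within {0..1})"
      unfolding k_def using that L by (auto intro!: derivative_eq_intros dE)
    moreover have "exp (u x) / L = exp (u x + c)"
      using L by (simp add: c_def exp_diff)
    ultimately show ?thesis by simp
  qed
  have dh: "(h has_real_derivative exp (u x + c)) (at x within {0..1})" if "x \<in> {0..1}" for x
    by (rule has_field_derivative_transform_within[OF dk[OF that] zero_less_one that]) (simp add: h_def)
  have h01: "h 0 = 0" "h 1 = 1" using L by (auto simp: h_def k_def L_def)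
  have less: "h x < h y" if "x \<in> {0..1}" "y \<in> {0..1}" "x < y" for x y
  proof -
    obtain z where "h y - h x = exp (u z + c) * (y - x)"
      using mean_value_unit_interval[OF dh \<open>x \<in> {0..1}\<close> \<open>y \<in> {0..1}\<close>] by blast
    moreover have "exp (u z + c) * (y - x) > 0" using \<open>x < y\<close> by simp
    ultimately show ?thesis by linarith
  qed
  have le: "h x \<le> h y" if "x \<in> {0..1}" "y \<in> {0..1}" "x \<le> y" for x y
    using less[OF that(1,2)] that by (cases "x = y") auto
  have ch: "continuous_on {0..1} h" using dh by (rule DERIV_continuous_on)
  have "h ` {0..1} = {0..1}"
  proof
    show "h ` {0..1} \<subseteq> {0..1}" using le[of 0] le[of _ 1] h01 by force
    show "{0..1} \<subseteq> h ` {0..1}"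
    proof
      fix y :: real assume "y \<in> {0..1}"
      then show "y \<in> h ` {0..1}" using IVT'[of h 0 y 1] ch h01 by force
    qed
  qed
  moreover have "inj_on h {0..1}"
    by (rule linorder_inj_onI') (use less in force)
  ultimately have "bij_betw h {0..1} {0..1}" by (simp add: bij_betw_def)
  moreover have "mono_on {0..1} h" using le by (auto simp: monotone_on_def)
  moreover have "continuous_on {0..1} (\<lambda>x. exp (u x + c))"
    by (intro continuous_intros continuous_on_subset[OF assms]) auto
  moreover have "h x = x" if "x \<notin> {0..1}" for x using that unfolding h_def by (rule if_not_P)
  ultimately have "diff1p h"
    unfolding diff1p_def using dh by (intro conjI exI[of _ "\<lambda>x. exp (u x + c)"]) auto
  then show ?thesis using dh by blast
qed

section \<open>Conjugation and asymptotic isometries\<close>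

text \<open>Chain rule; the normalising constant \<open>c\<close> enters once from \<open>h\<close>
  and once from its inverse, and cancels.\<close>

lemma conjugate_derivative:
  assumes h: "diff1p h" "\<And>x. x \<in> {0..1} \<Longrightarrow> (h has_real_derivative exp (u x + c)) (at x within {0..1})"
    and g: "g ` {0..1} = {0..1}"
      "\<And>x. x \<in> {0..1} \<Longrightarrow> (g has_real_derivative exp (\<gamma> x)) (at x within {0..1})"
    and y: "y \<in> {0..1}" and x_def: "x = inv h y"
  shows "(h \<circ> g \<circ> inv h has_real_derivative exp (u (g x) - u x + \<gamma> x)) (at y within {0..1})"
proof -
  note hf = diff1pD[OF h(1)]
  have inj: "inj h" using hf(1) strict_mono_imp_inj_on by blast
  have x: "x \<in> {0..1}" using hf(8) y x_def by blast
  have hx: "h x = y" unfolding x_def using hf(2) by (simp add: surj_f_inv_f)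
  have gx: "g x \<in> {0..1}" using g x by blast
  have inv: "(inv h has_real_derivative 1 / exp (u x + c)) (at y within {0..1})"
    using has_real_derivative_inverse_within[OF h(2)[OF x] _ _ x hf(3,4), of "inv h"] inj hx
    by simp
  have "(h \<circ> g has_real_derivative exp (u (g x) + c) * exp (\<gamma> x)) (at x within {0..1})"
    using h(2)[OF gx] g by (intro DERIV_image_chain g(2)[OF x]) auto
  then have "((h \<circ> g) \<circ> inv h has_real_derivative
      (exp (u (g x) + c) * exp (\<gamma> x)) * (1 / exp (u x + c))) (at y within {0..1})"
    using hf(8) x_def by (intro DERIV_image_chain[where g = "inv h"] inv) simp
  moreover have "(exp (u (g x) + c) * exp (\<gamma> x)) * (1 / exp (u x + c)) = exp (u (g x) - u x + \<gamma> x)"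
    by (simp add: exp_add exp_diff)
  ultimately show ?thesis by simp
qed

text \<open>In the metrics \<open>exp (u n x) dx\<close> the map \<open>g\<close> is an isometry up to a factor tending uniformly
  to 1.\<close>

definition asymptotic_isometry :: "(nat \<Rightarrow> real \<Rightarrow> real) \<Rightarrow> (real \<Rightarrow> real) \<Rightarrow> bool" where
  "asymptotic_isometry u g \<longleftrightarrow> g ` {0..1} = {0..1} \<and> g 0 = 0 \<and> (\<exists>\<gamma>.
      (\<forall>x\<in>{0..1}. (g has_real_derivative exp (\<gamma> x)) (at x within {0..1})) \<and>
      (\<forall>\<epsilon>>0. \<forall>\<^sub>F n in sequentially. \<forall>x\<in>{0..1}. \<bar>u n (g x) - u n x + \<gamma> x\<bar> < \<epsilon>))"

lemma asymptotic_isometryI: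
  assumes "g ` {0..1} = {0..1}" "g 0 = 0"
    "\<And>x. x \<in> {0..1} \<Longrightarrow> (g has_real_derivative exp (\<gamma> x)) (at x within {0..1})"
    "\<And>\<epsilon>. \<epsilon> > 0 \<Longrightarrow> \<forall>\<^sub>F n in sequentially. \<forall>x\<in>{0..1}. \<bar>u n (g x) - u n x + \<gamma> x\<bar> < \<epsilon>"
  shows "asymptotic_isometry u g"
  using assms unfolding asymptotic_isometry_def by blast

text \<open>The conjugate has derivative \<open>exp\<close> of the defect at
  \<open>inv (h n) y\<close>, hence uniformly close to 1. Closeness of values follows by the mean
  value theorem from 0, which the conjugate fixes.\<close>

lemma C1_tendsto_id_conjugates:
  fixes h u :: "nat \<Rightarrow> real \<Rightarrow> real" and c :: "nat \<Rightarrow> real"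
  assumes h: "\<And>n. diff1p (h n)"
      "\<And>n x. x \<in> {0..1} \<Longrightarrow> (h n has_real_derivative exp (u n x + c n)) (at x within {0..1})"
    and "asymptotic_isometry u g"
  shows "C1_tendsto_id (\<lambda>n. h n \<circ> g \<circ> inv (h n))"
proof -
  obtain \<gamma> where g: "g ` {0..1} = {0..1}" "g 0 = 0"
      "\<And>x. x \<in> {0..1} \<Longrightarrow> (g has_real_derivative exp (\<gamma> x)) (at x within {0..1})"
    and lim: "\<And>\<epsilon>. \<epsilon> > 0 \<Longrightarrow> \<forall>\<^sub>F n in sequentially. \<forall>x\<in>{0..1}. \<bar>u n (g x) - u n x + \<gamma> x\<bar> < \<epsilon>"
    using assms(3) unfolding asymptotic_isometry_def by blast
  show ?thesis
    unfolding C1_tendsto_id_def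
  proof (intro allI impI)
    fix \<epsilon> :: real assume "\<epsilon> > 0"
    have "isCont exp (0::real)" by simp
    then obtain \<delta> where \<delta>: "\<delta> > 0" "\<And>t::real. \<bar>t\<bar> < \<delta> \<Longrightarrow> \<bar>exp t - 1\<bar> < \<epsilon>"
      using \<open>\<epsilon> > 0\<close> unfolding continuous_at_eps_delta by (auto simp: dist_real_def)
    show "\<forall>\<^sub>F n in sequentially. \<forall>x\<in>{0..1}. \<bar>(h n \<circ> g \<circ> inv (h n)) x - x\<bar> < \<epsilon> \<and>
        \<bar>d1 (h n \<circ> g \<circ> inv (h n)) x - 1\<bar> < \<epsilon>"
      using lim[OF \<delta>(1)]
    proof eventually_elim
      case (elim n)
      define \<phi> where "\<phi> = h n \<circ> g \<circ> inv (h n)"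
      define e where "e y = exp (u n (g (inv (h n) y)) - u n (inv (h n) y) + \<gamma> (inv (h n) y))" for y
      have der: "(\<phi> has_real_derivative e y) (at y within {0..1})" if "y \<in> {0..1}" for y
        unfolding \<phi>_def e_def
        by (rule conjugate_derivative[OF h g(1,3) that refl])
      have e: "\<bar>e y - 1\<bar> < \<epsilon>" if "y \<in> {0..1}" for y
      proof -
        have "inv (h n) y \<in> {0..1}" using diff1pD(8)[OF h(1)] that by blast
        then show ?thesis unfolding e_def using elim \<delta>(2) by blast
      qed
      have \<phi>0: "\<phi> 0 = 0" using diff1pD(5,9)[OF h(1)] g(2) by (simp add: \<phi>_def)
      show ?case
        unfolding \<phi>_def[symmetric]
      proof (intro ballI conjI)
        fix y :: real assume y: "y \<in> {0..1}"
        show "\<bar>d1 \<phi> y - 1\<bar> < \<epsilon>" using d1_eqI[OF der[OF y] y] e[OF y] by simp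
        obtain z where z: "z \<in> {0..1}" "\<phi> y - \<phi> 0 = e z * (y - 0)"
          using mean_value_unit_interval[OF der, of 0 y] y by auto
        have "\<phi> y - y = (e z - 1) * y" using z \<phi>0 by (simp add: left_diff_distrib)
        then have "\<bar>\<phi> y - y\<bar> = \<bar>e z - 1\<bar> * y" using y by (simp add: abs_mult)
        also have "\<dots> \<le> \<bar>e z - 1\<bar> * 1" using y by (intro mult_left_mono) auto
        finally show "\<bar>\<phi> y - y\<bar> < \<epsilon>" using e[OF z(1)] by simp
      qed
    qed
  qed
qed

text \<open>Cocycle identity: the defect of \<open>f \<circ> g\<close> at \<open>x\<close> is that
  of \<open>f\<close> at \<open>g x\<close> plus that of \<open>g\<close> at
  \<open>x\<close>.\<close>

lemma asymptotic_isometry_comp: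
  assumes "asymptotic_isometry u f" "asymptotic_isometry u g"
  shows "asymptotic_isometry u (f \<circ> g)"
proof -
  obtain \<psi> where f: "f ` {0..1} = {0..1}" "f 0 = 0"
    and \<psi>: "\<And>x. x \<in> {0..1} \<Longrightarrow> (f has_real_derivative exp (\<psi> x)) (at x within {0..1})"
      "\<And>\<epsilon>. \<epsilon> > 0 \<Longrightarrow> \<forall>\<^sub>F n in sequentially. \<forall>x\<in>{0..1}. \<bar>u n (f x) - u n x + \<psi> x\<bar> < \<epsilon>"
    using assms(1) unfolding asymptotic_isometry_def by blast
  obtain \<gamma> where g: "g ` {0..1} = {0..1}" "g 0 = 0"
    and \<gamma>: "\<And>x. x \<in> {0..1} \<Longrightarrow> (g has_real_derivative exp (\<gamma> x)) (at x within {0..1})"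
      "\<And>\<epsilon>. \<epsilon> > 0 \<Longrightarrow> \<forall>\<^sub>F n in sequentially. \<forall>x\<in>{0..1}. \<bar>u n (g x) - u n x + \<gamma> x\<bar> < \<epsilon>"
    using assms(2) unfolding asymptotic_isometry_def by blast
  have gx: "g x \<in> {0..1}" if "x \<in> {0..1}" for x using g that by blast
  show ?thesis
  proof (rule asymptotic_isometryI)
    show "(f \<circ> g) ` {0..1} = {0..1}" using f g by (metis image_comp)
    show "(f \<circ> g) 0 = 0" using f g by simp
    show "(f \<circ> g has_real_derivative exp (\<psi> (g x) + \<gamma> x)) (at x within {0..1})" if "x \<in> {0..1}" for x
      unfolding exp_add using \<psi>(1)[OF gx[OF that]] g by (intro DERIV_image_chain \<gamma>(1)[OF that]) auto
    show "\<forall>\<^sub>F n in sequentially. \<forall>x\<in>{0..1}.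
        \<bar>u n ((f \<circ> g) x) - u n x + (\<psi> (g x) + \<gamma> x)\<bar> < \<epsilon>" if "\<epsilon> > 0" for \<epsilon>
      using \<psi>(2)[of "\<epsilon>/2", OF half_gt_zero[OF that]] \<gamma>(2)[of "\<epsilon>/2", OF half_gt_zero[OF that]]
    proof eventually_elim
      case (elim n)
      show ?case
      proof
        fix x :: real assume x: "x \<in> {0..1}"
        have "\<bar>u n (f (g x)) - u n (g x) + \<psi> (g x)\<bar> < \<epsilon>/2" "\<bar>u n (g x) - u n x + \<gamma> x\<bar> < \<epsilon>/2"
          using elim gx[OF x] x by blast+
        then show "\<bar>u n ((f \<circ> g) x) - u n x + (\<psi> (g x) + \<gamma> x)\<bar> < \<epsilon>"
          unfolding o_def by linarith
      qed
    qed
  qed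
qed

text \<open>The defect of \<open>inv f\<close> at \<open>x\<close> is minus the defect of
  \<open>f\<close> at \<open>inv f x\<close>.\<close>

lemma asymptotic_isometry_inv:
  assumes "asymptotic_isometry u f" "inj f"
  shows "asymptotic_isometry u (inv f)"
proof -
  obtain \<psi> where f: "f ` {0..1} = {0..1}" "f 0 = 0"
    and \<psi>: "\<And>x. x \<in> {0..1} \<Longrightarrow> (f has_real_derivative exp (\<psi> x)) (at x within {0..1})"
      "\<And>\<epsilon>. \<epsilon> > 0 \<Longrightarrow> \<forall>\<^sub>F n in sequentially. \<forall>x\<in>{0..1}. \<bar>u n (f x) - u n x + \<psi> x\<bar> < \<epsilon>"
    using assms(1) unfolding asymptotic_isometry_def by blast
  have im: "inv f ` {0..1} = {0..1}" using image_inv_f_f[OF assms(2), of "{0..1}"] f by simp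
  have cf: "continuous_on {0..1} f" using \<psi>(1) by (rule DERIV_continuous_on)
  have fx: "inv f x \<in> {0..1}" "f (inv f x) = x" if "x \<in> {0..1}" for x
    using im that f by (blast, metis f_inv_into_f image_mono subsetD top_greatest)
  show ?thesis
  proof (rule asymptotic_isometryI)
    show "inv f ` {0..1} = {0..1}" by (rule im)
    show "inv f 0 = 0" using assms(2) f by (metis inv_f_f)
    show "(inv f has_real_derivative exp (- \<psi> (inv f x))) (at x within {0..1})" if "x \<in> {0..1}" for x
      using has_real_derivative_inverse_within[OF \<psi>(1)[OF fx(1)[OF that]] _ _ fx(1)[OF that] cf f(1), of "inv f"]
        fx(2)[OF that] assms(2) by (simp add: exp_minus divide_inverse)
    show "\<forall>\<^sub>F n in sequentially. \<forall>x\<in>{0..1}. \<bar>u n (inv f x) - u n x + - \<psi> (inv f x)\<bar> < \<epsilon>"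
      if "\<epsilon> > 0" for \<epsilon>
      using \<psi>(2)[OF that]
    proof eventually_elim
      case (elim n)
      show ?case
      proof
        fix x :: real assume x: "x \<in> {0..1}"
        have "\<bar>u n (f (inv f x)) - u n (inv f x) + \<psi> (inv f x)\<bar> < \<epsilon>"
          using elim fx(1)[OF x] by blast
        then show "\<bar>u n (inv f x) - u n x + - \<psi> (inv f x)\<bar> < \<epsilon>" using fx(2)[OF x] by simp
      qed
    qed
  qed
qed

lemma gen_group_asymptotic_isometry:
  assumes "\<And>f. f \<in> F \<Longrightarrow> inj f" "\<And>f. f \<in> F \<Longrightarrow> asymptotic_isometry u f"
    and "g \<in> gen_group F"
  shows "asymptotic_isometry u g"
  using assms(3)
proof induction
  case gen_id
  show ?case by (rule asymptotic_isometryI[where \<gamma> = "\<lambda>_. 0"]) (auto simp: id_def)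
next
  case (gen_mult g f)
  then show ?case using assms(2) by (intro asymptotic_isometry_comp)
next
  case (gen_inv g f)
  then show ?case using assms(1,2) by (intro asymptotic_isometry_comp asymptotic_isometry_inv)
qed

section \<open>From finite subfamilies to the whole group\<close>

theorem theoremt2:
  fixes f :: "nat \<Rightarrow> real \<Rightarrow> real" and I :: "nat \<Rightarrow> real set"
  assumes "\<And>n. diff1p (f n)"
    and "\<And>n. f n \<noteq> id"
    and "\<And>n. no_hyperbolic_fixed_points (f n)"
    and "\<And>n. fundamental_domain (f n) (I n)"
    and "\<And>i n. i < n \<Longrightarrow> supp (f n) \<subseteq> I i \<or> supp (f i) \<subseteq> I n \<or>
            interior (supp (f n)) \<inter> interior (supp (f i)) = {}"
  shows "C1_close_to_id (gen_group (range f))"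
proof -
  note f = diff1pD[OF assms(1)]
  have cf: "continuous_on UNIV (f i)" for i
    using diff1p_log_derivative(1)[OF assms(1,3)] .
  obtain \<psi> where c\<psi>: "\<And>i. continuous_on UNIV (\<psi> i)" and fix0: "\<And>i x. f i x = x \<Longrightarrow> \<psi> i x = 0"
    and der: "\<And>i x. x \<in> {0..1} \<Longrightarrow> (f i has_real_derivative exp (\<psi> i x)) (at x within {0..1})"
    using diff1p_log_derivative(2)[OF assms(1,3)] by metis
  obtain p where p: "\<And>i. f i (p i) \<noteq> p i" and I: "\<And>i. I i = closed_segment (p i) (f i (p i))"
    using assms(4) unfolding fundamental_domain_def by metis
  have op: "open {x. f i x \<noteq> x}" for i
    by (intro open_Collect_neq cf continuous_on_id)
  have sub: "{x. f i x \<noteq> x} \<subseteq> interior (supp (f i))" for i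
    unfolding supp_def by (intro interior_maximal closure_subset op)
  \<comment> \<open>The set of moved points is open, so it avoids the endpoints of any segment
    containing it.\<close>
  have segment: "{x. f i x \<noteq> x} \<subseteq> open_segment (p j) (f j (p j))" if "supp (f i) \<subseteq> I j" for i j
  proof -
    have "{x. f i x \<noteq> x} \<subseteq> interior (I j)"
      using sub[of i] interior_mono[OF that] by blast
    then show ?thesis
      by (simp add: I closed_segment_eq_real_ivl open_segment_eq_real_ivl split: if_splits)
  qed
  have nested': "{x. f i x \<noteq> x} \<subseteq> open_segment (p j) (f j (p j)) \<or>
      {x. f j x \<noteq> x} \<subseteq> open_segment (p i) (f i (p i)) \<or>
      {x. f i x \<noteq> x} \<inter> {x. f j x \<noteq> x} = {}" if "i < j" for i j
    using assms(5)[OF that] segment[of i j] segment[of j i] sub[of i] sub[of j] by blast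
  have nested: "{x. f i x \<noteq> x} \<subseteq> open_segment (p j) (f j (p j)) \<or>
      {x. f j x \<noteq> x} \<subseteq> open_segment (p i) (f i (p i)) \<or>
      {x. f i x \<noteq> x} \<inter> {x. f j x \<noteq> x} = {}" if "i \<noteq> j" for i j
    using that nested'[of i j] nested'[of j i] by (metis Int_commute linorder_neqE_nat)
  have lip: "\<exists>K\<ge>1. \<forall>z\<in>{0..1}. f i z = z \<longrightarrow>
      (\<forall>x. \<bar>f i x - z\<bar> \<le> K * \<bar>x - z\<bar> \<and> \<bar>x - z\<bar> \<le> K * \<bar>f i x - z\<bar>)" for i
    by (rule bilipschitz_at_fixed_points[OF f(7) c\<psi> der])
  \<comment> \<open>Diagonal choice: the \<open>n\<close>-th density treats \<open>f 0\<close> to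
    \<open>f n\<close> with tolerance \<open>1 / Suc n\<close>, so each fixed generator is covered
    from index \<open>i\<close> on.\<close>
  have "\<exists>u. continuous_on UNIV u \<and> (\<forall>i\<le>n. \<forall>x. \<bar>u (f i x) - u x + \<psi> i x\<bar> < 1 / Suc n)" for n
  proof -
    have "\<exists>u. continuous_on UNIV u \<and> (\<forall>x. (\<forall>i\<in>{..n}. f i x = x) \<longrightarrow> u x = 0) \<and>
        (\<forall>i\<in>{..n}. \<forall>x. \<bar>u (f i x) - u x + \<psi> i x\<bar> < 1 / Suc n)"
      by (rule finite_family_log_density[where p = p];
          (fact f(1) f(2) f(7) cf c\<psi> fix0 lip p nested finite_atMost | simp))
    then show ?thesis by (auto simp del: of_nat_Suc)
  qed
  then obtain u where cu: "\<And>n. continuous_on UNIV (u n)"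
    and u: "\<And>n i x. i \<le> n \<Longrightarrow> \<bar>u n (f i x) - u n x + \<psi> i x\<bar> < 1 / Suc n"
    by metis
  obtain h c where h: "\<And>n. diff1p (h n)"
      "\<And>n x. x \<in> {0..1} \<Longrightarrow> (h n has_real_derivative exp (u n x + c n)) (at x within {0..1})"
    using diff1p_of_log_density[OF cu] by metis
  have "asymptotic_isometry u (f i)" for i
  proof (rule asymptotic_isometryI[OF f(4,5) der])
    fix \<epsilon> :: real assume "\<epsilon> > 0"
    then have "\<forall>\<^sub>F n in sequentially. 1 / real (Suc n) < \<epsilon>"
      using LIMSEQ_Suc[OF lim_1_over_n] by (auto dest: order_tendstoD)
    then show "\<forall>\<^sub>F n in sequentially. \<forall>x\<in>{0..1}. \<bar>u n (f i x) - u n x + \<psi> i x\<bar> < \<epsilon>"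
      using eventually_ge_at_top[of i]
    proof eventually_elim
      case (elim n)
      then show ?case using u[of i n] by (meson less_trans)
    qed
  qed
  moreover have "inj (f i)" for i using f(1) strict_mono_imp_inj_on by blast
  ultimately have "asymptotic_isometry u g" if "g \<in> gen_group (range f)" for g
    using gen_group_asymptotic_isometry[OF _ _ that, of u] by blast
  then have "\<forall>g\<in>gen_group (range f). C1_tendsto_id (\<lambda>n. h n \<circ> g \<circ> inv (h n))"
    using C1_tendsto_id_conjugates[OF h] by simp
  then show ?thesis unfolding C1_close_to_id_def using h(1) by (intro exI[of _ h]) simp
qed

end
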